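(* For programs $M,N:\mathtt{Bool}$ we have: $M\approx N$ if and only if $M\approx_{\mathrm{Ob}_v}N$.
   Context: **Language.** Fix base types $b$, including $\mathtt{Bool}$ and $\mathtt{Rew}$; for each $b$ a set of constants $c:b$ (including $\mathtt{tt},\mathtt{ff}:\mathtt{Bool}$, $0:\mathtt{Rew}$); and function symbols $f:b_1\ldots b_m\to b$, including $=_b\,:b\,b\to\mathtt{Bool}$ for each $b$, $+:\mathtt{Rew}\,\mathtt{Rew}\to\mathtt{Rew}$ and $\le\,:\mathtt{Rew}\,\mathtt{Rew}\to\mathtt{Bool}$. Types: $\sigma::=b\mid\mathtt{Unit}\mid\sigma\times\sigma\mid\sigma\to\sigma$. Terms: $M::=x\mid c\mid f(M_1,\dots,M_m)\mid\mathtt{if}\,L\,\mathtt{then}\,M\,\mathtt{else}\,N\mid M\,\mathtt{or}\,N\mid N\cdot M\mid *\mid\langle M,N\rangle\mid\mathtt{fst}(M)\mid\mathtt{snd}(M)\mid\lambda x{:}\sigma.M\mid MN$, up to $\alpha$-equivalence, with standard simple typing; $M\,\mathtt{or}\,N:\sigma$ when $M,N:\sigma$, and $N\cdot M:\sigma$ when $N:\mathtt{Rew}$, $M:\sigma$. Programs are closed well-typed terms. Values (closed): $V::=c\mid *\mid\langle V,W\rangle\mid\lambda x{:}\sigma.M$; $\mathrm{Val}_\sigma$ is the set of values of type $\sigma$. Effect values: $E::=V\mid E_1\,\mathtt{or}\,E_2\mid c\cdot E$ ($c:\mathtt{Rew}$). **Ordinary operational semantics.** Evaluation contexts (closed): $\mathcal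 E::=[\,]\mid f(c_1,\dots,c_{k-1},\mathcal E,M_{k+1},\dots,M_m)\mid\mathtt{if}\,\mathcal E\,\mathtt{then}\,M\,\mathtt{else}\,N\mid\mathcal E\cdot M\mid\langle\mathcal E,N\rangle\mid\langle V,\mathcal E\rangle\mid\mathtt{fst}(\mathcal E)\mid\mathtt{snd}(\mathcal E)\mid\mathcal EN\mid(\lambda x{:}\sigma.M)\mathcal E$. Constants $\mathrm{val}_f(c_1,\dots,c_m):b$ are given for all $f$ and $c_i:b_i$, with $\mathrm{val}_{=_b}(c,c')=\mathtt{tt}$ if $c=c'$, else $\mathtt{ff}$. Steps $\mathcal E[Q]\to\mathcal E[Q']$ arise from: $f(c_1,\dots,c_m)\to\mathrm{val}_f(c_1,\dots,c_m)$; $\mathtt{if}\,\mathtt{tt}\,\mathtt{then}\,M\,\mathtt{else}\,N\to M$; $\mathtt{if}\,\mathtt{ff}\,\mathtt{then}\,M\,\mathtt{else}\,N\to N$; $\mathtt{fst}\langle V,W\rangle\to V$; $\mathtt{snd}\langle V,W\rangle\to W$; $(\lambda x{:}\sigma.M)V\to M[V/x]$. Evaluation is deterministic and terminating, and each program $M:\sigma$ has an effect value $\mathrm{Op}(M):\sigma$ determined by $\mathrm{Op}(V)=V$; $\mathrm{Op}(M)=\mathrm{Op}(M')$ if $M\to M'$; $\mathrm{Op}(\mathcal E[M_1\,\mathtt{or}\,M_2])=\mathrm{Op}(\mathcal E[M_1])\,\mathtt{or}\,\mathrm{Op}(\mathcal E[M_2])$; $\mathrm{Op}(\mathcal E[c\cdot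 M_1])=c\cdot\mathrm{Op}(\mathcal E[M_1])$. **Rewards and interpretation.** $R$ is a set with a commutative monoid structure $(+,0)$ and a total order $\le$ such that $r\le s\iff r+t\le s+t$. Given are nonempty sets $[\![b]\!]$ with $[\![\mathtt{Bool}]\!]=\{0,1\}$, $[\![\mathtt{Rew}]\!]=R$; elements $[\![c]\!]\in[\![b]\!]$ for $c:b$ with $[\![\mathtt{tt}]\!]=1$, $[\![\mathtt{ff}]\!]=0$, $[\![0]\!]=0$, distinct constants of the same type having distinct denotations, and $[\![c]\!]\ne0$ for some $c:\mathtt{Rew}$; and functions $[\![f]\!]:[\![b_1]\!]\times\cdots\times[\![b_m]\!]\to[\![b]\!]$ with $[\![+]\!]$ and $[\![\le]\!]$ the addition and (characteristic function of the) order of $R$, and $[\![f]\!]([\![c_1]\!],\dots,[\![c_m]\!])=[\![\mathrm{val}_f(c_1,\dots,c_m)]\!]$. **Selection operational semantics.** Strategies: a value has the single strategy $*$; those of $E_1\,\mathtt{or}\,E_2$ are $1s$ ($s\in\mathrm{Str}(E_1)$) and $2s$ ($s\in\mathrm{Str}(E_2)$); those of $c\cdot E$ are those of $E$. Outcomes: $\mathrm{Out}( *,V)=\langle0,V\rangle$, $\mathrm{Out}(is,E_1\,\mathtt{or}\,E_2)=\mathrm{Out}(s,E_i)$, and $\mathrm{Out}(s,c\cdot E)=\langle[\![c]\!]+r,V\rangle$ if $\mathrm{Out}(s,E)=\langle r,V\rangle$. $\mathrm{Rew}(s,E)=\pi_1(\mathrm{Out}(s,E))$. Strategies are totally ordered: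 on $E_1\,\mathtt{or}\,E_2$ all $1s$ precede all $2s'$, each group ordered as in $E_1$, resp. $E_2$; on $c\cdot E$ as in $E$. $\mathrm{argmax}$ picks the least maximizing strategy. $\mathrm{Op}_s(M)=\mathrm{Out}(\mathrm{argmax}_{s\in\mathrm{Str}(\mathrm{Op}(M))}\mathrm{Rew}(s,\mathrm{Op}(M)),\mathrm{Op}(M))\in R\times\mathrm{Val}_\sigma$. **Observational equivalences.** For a function $\mathrm{Ob}$ on programs of type $\mathtt{Bool}$ and programs $M,N:\sigma$, $M\approx_{\mathrm{Ob}}N$ iff $\mathrm{Ob}(C[M])=\mathrm{Ob}(C[N])$ for every one-hole context $C[\;]$ such that $C[L]:\mathtt{Bool}$ is a program for every program $L:\sigma$. $\approx$ is $\approx_{\mathrm{Op}_s}$, and $\mathrm{Ob}_v(M)=\pi_2(\mathrm{Op}_s(M))$ (observing only the final value). *)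

theory Defs
  imports Main
begin

section \<open>Language\<close>

text \<open>
  The type parameters \<open>'b\<close>, \<open>'c\<close>, \<open>'f\<close> are the sets of base types, constants and function
  symbols. Every constant has exactly one base type. The field \<open>val\<close> gives the constants
  \<open>val\<^sub>f(c\<^sub>1,\<dots>,c\<^sub>m)\<close>; it is only relevant on argument lists of the type required by \<open>f\<close>.
\<close>

record ('b, 'c, 'f) language =
  bool_base :: 'b
  rew_base :: 'b
  const_type :: "'c \<Rightarrow> 'b"
  tt :: 'c
  ff :: 'c
  zero_rew :: 'c
  arg_types :: "'f \<Rightarrow> 'b list"
  res_type :: "'f \<Rightarrow> 'b"
  eq_sym :: "'b \<Rightarrow> 'f"
  plus_sym :: 'f
  leq_sym :: 'f
  val :: "'f \<Rightarrow> 'c list \<Rightarrow> 'c"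

locale selection_language =
  fixes L :: "('b, 'c, 'f) language"
  assumes bool_neq_rew: "bool_base L \<noteq> rew_base L"
    and tt_type: "const_type L (tt L) = bool_base L"
    and ff_type: "const_type L (ff L) = bool_base L"
    and zero_type: "const_type L (zero_rew L) = rew_base L"
    and eq_type: "\<And>b. arg_types L (eq_sym L b) = [b, b] \<and> res_type L (eq_sym L b) = bool_base L"
    and plus_type: "arg_types L (plus_sym L) = [rew_base L, rew_base L]
                    \<and> res_type L (plus_sym L) = rew_base L"
    and leq_type: "arg_types L (leq_sym L) = [rew_base L, rew_base L]
                   \<and> res_type L (leq_sym L) = bool_base L"
    and val_type: "\<And>f cs. map (const_type L) cs = arg_types L f \<Longrightarrow>
                     const_type L (val L f cs) = res_type L f"
    and val_eq: "\<And>b c c'. const_type L c = b \<Longrightarrow> const_type L c' = b \<Longrightarrow>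
                   val L (eq_sym L b) [c, c'] = (if c = c' then tt L else ff L)"

datatype 'b ty = Base 'b | UnitT | ProdT "'b ty" "'b ty" | FunT "'b ty" "'b ty"

text \<open>
  Terms up to alpha-equivalence, in de Bruijn notation: \<open>Var i\<close> refers to the \<open>i\<close>-th
  enclosing binder, counting from 0. \<open>Rwd N M\<close> is \<open>N \<cdot> M\<close>.
\<close>

datatype ('b, 'c, 'f) tm =
    Var nat
  | Const 'c
  | FApp 'f "('b, 'c, 'f) tm list"
  | Ite "('b, 'c, 'f) tm" "('b, 'c, 'f) tm" "('b, 'c, 'f) tm"
  | Or "('b, 'c, 'f) tm" "('b, 'c, 'f) tm"
  | Rwd "('b, 'c, 'f) tm" "('b, 'c, 'f) tm"
  | Star
  | Tup "('b, 'c, 'f) tm" "('b, 'c, 'f) tm"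
  | Fst "('b, 'c, 'f) tm"
  | Snd "('b, 'c, 'f) tm"
  | Lam "'b ty" "('b, 'c, 'f) tm"
  | App "('b, 'c, 'f) tm" "('b, 'c, 'f) tm"

inductive typing ::
  "('b, 'c, 'f) language \<Rightarrow> 'b ty list \<Rightarrow> ('b, 'c, 'f) tm \<Rightarrow> 'b ty \<Rightarrow> bool"
  for L :: "('b, 'c, 'f) language" where
  T_Var: "i < length \<Gamma> \<Longrightarrow> typing L \<Gamma> (Var i) (\<Gamma> ! i)"
| T_Const: "typing L \<Gamma> (Const c) (Base (const_type L c))"
| T_FApp: "list_all2 (\<lambda>M b. typing L \<Gamma> M (Base b)) Ms (arg_types L f) \<Longrightarrow>
    typing L \<Gamma> (FApp f Ms) (Base (res_type L f))"
| T_Ite: "typing L \<Gamma> B (Base (bool_base L)) \<Longrightarrow> typing L \<Gamma> M \<sigma> \<Longrightarrow> typing L \<Gamma> N \<sigma> \<Longrightarrow>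
    typing L \<Gamma> (Ite B M N) \<sigma>"
| T_Or: "typing L \<Gamma> M \<sigma> \<Longrightarrow> typing L \<Gamma> N \<sigma> \<Longrightarrow> typing L \<Gamma> (Or M N) \<sigma>"
| T_Rwd: "typing L \<Gamma> N (Base (rew_base L)) \<Longrightarrow> typing L \<Gamma> M \<sigma> \<Longrightarrow> typing L \<Gamma> (Rwd N M) \<sigma>"
| T_Star: "typing L \<Gamma> Star UnitT"
| T_Tup: "typing L \<Gamma> M \<sigma> \<Longrightarrow> typing L \<Gamma> N \<tau> \<Longrightarrow> typing L \<Gamma> (Tup M N) (ProdT \<sigma> \<tau>)"
| T_Fst: "typing L \<Gamma> M (ProdT \<sigma> \<tau>) \<Longrightarrow> typing L \<Gamma> (Fst M) \<sigma>"
| T_Snd: "typing L \<Gamma> M (ProdT \<sigma> \<tau>) \<Longrightarrow> typing L \<Gamma> (Snd M) \<tau>"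
| T_Lam: "typing L (\<sigma> # \<Gamma>) M \<tau> \<Longrightarrow> typing L \<Gamma> (Lam \<sigma> M) (FunT \<sigma> \<tau>)"
| T_App: "typing L \<Gamma> M (FunT \<sigma> \<tau>) \<Longrightarrow> typing L \<Gamma> N \<sigma> \<Longrightarrow> typing L \<Gamma> (App M N) \<tau>"

definition program :: "('b, 'c, 'f) language \<Rightarrow> ('b, 'c, 'f) tm \<Rightarrow> 'b ty \<Rightarrow> bool" where
  "program L M \<sigma> \<longleftrightarrow> typing L [] M \<sigma>"

text \<open>
  The predicates below are syntactic. They are only ever applied to programs, hence to closed
  terms, so closedness of values and evaluation contexts is not required separately.
\<close>

inductive is_val :: "('b, 'c, 'f) tm \<Rightarrow> bool" where
  "is_val (Const c)"
| "is_val Star"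
| "is_val V \<Longrightarrow> is_val W \<Longrightarrow> is_val (Tup V W)"
| "is_val (Lam \<sigma> M)"

text \<open>
  \<open>subst k V M\<close> replaces index \<open>k\<close> in \<open>M\<close> by \<open>V\<close> and closes the gap. There is no shifting of
  \<open>V\<close> under binders, since only closed values are substituted.
\<close>

fun subst :: "nat \<Rightarrow> ('b, 'c, 'f) tm \<Rightarrow> ('b, 'c, 'f) tm \<Rightarrow> ('b, 'c, 'f) tm" where
  "subst k V (Var i) = (if i < k then Var i else if i = k then V else Var (i - 1))"
| "subst k V (Const c) = Const c"
| "subst k V (FApp f Ms) = FApp f (map (subst k V) Ms)"
| "subst k V (Ite B M N) = Ite (subst k V B) (subst k V M) (subst k V N)"
| "subst k V (Or M N) = Or (subst k V M) (subst k V N)"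
| "subst k V (Rwd N M) = Rwd (subst k V N) (subst k V M)"
| "subst k V Star = Star"
| "subst k V (Tup M N) = Tup (subst k V M) (subst k V N)"
| "subst k V (Fst M) = Fst (subst k V M)"
| "subst k V (Snd M) = Snd (subst k V M)"
| "subst k V (Lam \<sigma> M) = Lam \<sigma> (subst (Suc k) V M)"
| "subst k V (App M N) = App (subst k V M) (subst k V N)"

section \<open>Contexts and observational equivalence\<close>

text \<open>
  One-hole contexts. Only closed terms are put into the hole, so \<open>fill\<close> does not shift indices
  when the hole lies under binders.
\<close>

datatype ('b, 'c, 'f) ctx =
    Hole
  | CFApp 'f "('b, 'c, 'f) tm list" "('b, 'c, 'f) ctx" "('b, 'c, 'f) tm list"
  | CIte1 "('b, 'c, 'f) ctx" "('b, 'c, 'f) tm" "('b, 'c, 'f) tm"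
  | CIte2 "('b, 'c, 'f) tm" "('b, 'c, 'f) ctx" "('b, 'c, 'f) tm"
  | CIte3 "('b, 'c, 'f) tm" "('b, 'c, 'f) tm" "('b, 'c, 'f) ctx"
  | COr1 "('b, 'c, 'f) ctx" "('b, 'c, 'f) tm"
  | COr2 "('b, 'c, 'f) tm" "('b, 'c, 'f) ctx"
  | CRwd1 "('b, 'c, 'f) ctx" "('b, 'c, 'f) tm"
  | CRwd2 "('b, 'c, 'f) tm" "('b, 'c, 'f) ctx"
  | CTup1 "('b, 'c, 'f) ctx" "('b, 'c, 'f) tm"
  | CTup2 "('b, 'c, 'f) tm" "('b, 'c, 'f) ctx"
  | CFst "('b, 'c, 'f) ctx"
  | CSnd "('b, 'c, 'f) ctx"
  | CLam "'b ty" "('b, 'c, 'f) ctx"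
  | CApp1 "('b, 'c, 'f) ctx" "('b, 'c, 'f) tm"
  | CApp2 "('b, 'c, 'f) tm" "('b, 'c, 'f) ctx"

primrec fill :: "('b, 'c, 'f) ctx \<Rightarrow> ('b, 'c, 'f) tm \<Rightarrow> ('b, 'c, 'f) tm" where
  "fill Hole P = P"
| "fill (CFApp f Ms C Ns) P = FApp f (Ms @ fill C P # Ns)"
| "fill (CIte1 C M N) P = Ite (fill C P) M N"
| "fill (CIte2 B C N) P = Ite B (fill C P) N"
| "fill (CIte3 B M C) P = Ite B M (fill C P)"
| "fill (COr1 C N) P = Or (fill C P) N"
| "fill (COr2 M C) P = Or M (fill C P)"
| "fill (CRwd1 C M) P = Rwd (fill C P) M"
| "fill (CRwd2 N C) P = Rwd N (fill C P)"
| "fill (CTup1 C N) P = Tup (fill C P) N"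
| "fill (CTup2 M C) P = Tup M (fill C P)"
| "fill (CFst C) P = Fst (fill C P)"
| "fill (CSnd C) P = Snd (fill C P)"
| "fill (CLam \<sigma> C) P = Lam \<sigma> (fill C P)"
| "fill (CApp1 C N) P = App (fill C P) N"
| "fill (CApp2 M C) P = App M (fill C P)"

definition obs_equiv ::
  "('b, 'c, 'f) language \<Rightarrow> (('b, 'c, 'f) tm \<Rightarrow> 'o) \<Rightarrow> 'b ty
     \<Rightarrow> ('b, 'c, 'f) tm \<Rightarrow> ('b, 'c, 'f) tm \<Rightarrow> bool" where
  "obs_equiv L Ob \<sigma> M N \<longleftrightarrow>
     (\<forall>C. (\<forall>P. program L P \<sigma> \<longrightarrow> program L (fill C P) (Base (bool_base L))) \<longrightarrow>
          Ob (fill C M) = Ob (fill C N))"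

section \<open>Ordinary operational semantics\<close>

inductive eval_ctx :: "('b, 'c, 'f) ctx \<Rightarrow> bool" where
  "eval_ctx Hole"
| "eval_ctx C \<Longrightarrow> eval_ctx (CFApp f (map Const cs) C Ms)"
| "eval_ctx C \<Longrightarrow> eval_ctx (CIte1 C M N)"
| "eval_ctx C \<Longrightarrow> eval_ctx (CRwd1 C M)"
| "eval_ctx C \<Longrightarrow> eval_ctx (CTup1 C N)"
| "is_val V \<Longrightarrow> eval_ctx C \<Longrightarrow> eval_ctx (CTup2 V C)"
| "eval_ctx C \<Longrightarrow> eval_ctx (CFst C)"
| "eval_ctx C \<Longrightarrow> eval_ctx (CSnd C)"
| "eval_ctx C \<Longrightarrow> eval_ctx (CApp1 C N)"
| "eval_ctx C \<Longrightarrow> eval_ctx (CApp2 (Lam \<sigma> M) C)"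

inductive red :: "('b, 'c, 'f) language \<Rightarrow> ('b, 'c, 'f) tm \<Rightarrow> ('b, 'c, 'f) tm \<Rightarrow> bool"
  for L :: "('b, 'c, 'f) language" where
  "map (const_type L) cs = arg_types L f \<Longrightarrow> red L (FApp f (map Const cs)) (Const (val L f cs))"
| "red L (Ite (Const (tt L)) M N) M"
| "red L (Ite (Const (ff L)) M N) N"
| "is_val V \<Longrightarrow> is_val W \<Longrightarrow> red L (Fst (Tup V W)) V"
| "is_val V \<Longrightarrow> is_val W \<Longrightarrow> red L (Snd (Tup V W)) W"
| "is_val V \<Longrightarrow> red L (App (Lam \<sigma> M) V) (subst 0 V M)"

inductive step :: "('b, 'c, 'f) language \<Rightarrow> ('b, 'c, 'f) tm \<Rightarrow> ('b, 'c, 'f) tm \<Rightarrow> bool"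
  for L :: "('b, 'c, 'f) language" where
  "eval_ctx C \<Longrightarrow> red L Q Q' \<Longrightarrow> step L (fill C Q) (fill C Q')"

text \<open>
  \<open>op_rel\<close> is the relation generated by the defining equations of \<open>Op\<close>. Its second component
  is always an effect value, i.e. a term built from values by \<open>Or\<close> and \<open>Rwd (Const c)\<close>. On
  programs it is total and single-valued because evaluation terminates and is deterministic.
\<close>

inductive op_rel :: "('b, 'c, 'f) language \<Rightarrow> ('b, 'c, 'f) tm \<Rightarrow> ('b, 'c, 'f) tm \<Rightarrow> bool"
  for L :: "('b, 'c, 'f) language" where
  "is_val V \<Longrightarrow> op_rel L V V"
| "step L M M' \<Longrightarrow> op_rel L M' E \<Longrightarrow> op_rel L M E"
| "eval_ctx C \<Longrightarrow> op_rel L (fill C M\<^sub>1) E\<^sub>1 \<Longrightarrow> op_rel L (fill C M\<^sub>2) E\<^sub>2 \<Longrightarrow>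
     op_rel L (fill C (Or M\<^sub>1 M\<^sub>2)) (Or E\<^sub>1 E\<^sub>2)"
| "eval_ctx C \<Longrightarrow> op_rel L (fill C M) E \<Longrightarrow>
     op_rel L (fill C (Rwd (Const c) M)) (Rwd (Const c) E)"

definition Op :: "('b, 'c, 'f) language \<Rightarrow> ('b, 'c, 'f) tm \<Rightarrow> ('b, 'c, 'f) tm" where
  "Op L M = (THE E. op_rel L M E)"

section \<open>Rewards and interpretation\<close>

text \<open>
  The set of rewards is a type \<open>'r\<close>. All sets \<open>\<lbrakk>b\<rbrakk>\<close> live in one universe, in which
  \<open>\<lbrakk>Bool\<rbrakk>\<close> and \<open>\<lbrakk>Rew\<rbrakk>\<close> are the copies of \<open>bool\<close> and \<open>'r\<close>; the remaining \<open>\<lbrakk>b\<rbrakk>\<close> are arbitrary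
  nonempty subsets.
\<close>

datatype ('r, 'x) sem = BoolV bool | RewV (the_rew: 'r) | OtherV 'x

record ('b, 'c, 'f, 'r, 'x) interp =
  base_den :: "'b \<Rightarrow> ('r, 'x) sem set"
  const_den :: "'c \<Rightarrow> ('r, 'x) sem"
  fun_den :: "'f \<Rightarrow> ('r, 'x) sem list \<Rightarrow> ('r, 'x) sem"

locale selection_model = selection_language L
  for L :: "('b, 'c, 'f) language" +
  fixes I :: "('b, 'c, 'f, 'r :: {comm_monoid_add, linorder}, 'x) interp"
  assumes add_le_iff: "\<And>r s t :: 'r. r \<le> s \<longleftrightarrow> r + t \<le> s + t"
    and base_nonempty: "\<And>b. base_den I b \<noteq> {}"
    and base_bool: "base_den I (bool_base L) = range BoolV"
    and base_rew: "base_den I (rew_base L) = range RewV"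
    and const_in: "\<And>c. const_den I c \<in> base_den I (const_type L c)"
    and const_tt: "const_den I (tt L) = BoolV True"
    and const_ff: "const_den I (ff L) = BoolV False"
    and const_zero: "const_den I (zero_rew L) = RewV 0"
    and const_distinct: "\<And>c c'. const_type L c = const_type L c' \<Longrightarrow> c \<noteq> c' \<Longrightarrow>
                           const_den I c \<noteq> const_den I c'"
    and const_nonzero: "\<exists>c. const_type L c = rew_base L \<and> const_den I c \<noteq> RewV 0"
    and fun_in: "\<And>f ds. list_all2 (\<lambda>d b. d \<in> base_den I b) ds (arg_types L f) \<Longrightarrow>
                   fun_den I f ds \<in> base_den I (res_type L f)"
    and fun_plus: "\<And>r s. fun_den I (plus_sym L) [RewV r, RewV s] = RewV (r + s)"
    and fun_leq: "\<And>r s. fun_den I (leq_sym L) [RewV r, RewV s] = BoolV (r \<le> s)"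
    and fun_val: "\<And>f cs. map (const_type L) cs = arg_types L f \<Longrightarrow>
                    fun_den I f (map (const_den I) cs) = const_den I (val L f cs)"

section \<open>Selection operational semantics\<close>

datatype strategy = Stop | One strategy | Two strategy

text \<open>
  The following functions are meant for effect values only; in them, a term that is neither an
  \<open>Or\<close> nor a \<open>Rwd\<close> is a value, and a \<open>Rwd\<close> has the form \<open>Rwd (Const c) E\<close>.
\<close>

fun Str :: "('b, 'c, 'f) tm \<Rightarrow> strategy set" where
  "Str (Or E\<^sub>1 E\<^sub>2) = One ` Str E\<^sub>1 \<union> Two ` Str E\<^sub>2"
| "Str (Rwd N E) = Str E"
| "Str V = {Stop}"

fun Out :: "('b, 'c, 'f, 'r :: {comm_monoid_add, linorder}, 'x) interp \<Rightarrow> strategy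
    \<Rightarrow> ('b, 'c, 'f) tm \<Rightarrow> 'r \<times> ('b, 'c, 'f) tm" where
  "Out I (One s) (Or E\<^sub>1 E\<^sub>2) = Out I s E\<^sub>1"
| "Out I (Two s) (Or E\<^sub>1 E\<^sub>2) = Out I s E\<^sub>2"
| "Out I s (Rwd N E) = (case N of Const c \<Rightarrow>
     (case Out I s E of (r, V) \<Rightarrow> (the_rew (const_den I c) + r, V)))"
| "Out I Stop V = (0, V)"

definition Rew :: "('b, 'c, 'f, 'r :: {comm_monoid_add, linorder}, 'x) interp \<Rightarrow> strategy
    \<Rightarrow> ('b, 'c, 'f) tm \<Rightarrow> 'r" where
  "Rew I s E = fst (Out I s E)"

inductive str_less :: "('b, 'c, 'f) tm \<Rightarrow> strategy \<Rightarrow> strategy \<Rightarrow> bool" where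
  "s \<in> Str E\<^sub>1 \<Longrightarrow> s' \<in> Str E\<^sub>2 \<Longrightarrow> str_less (Or E\<^sub>1 E\<^sub>2) (One s) (Two s')"
| "str_less E\<^sub>1 s s' \<Longrightarrow> str_less (Or E\<^sub>1 E\<^sub>2) (One s) (One s')"
| "str_less E\<^sub>2 s s' \<Longrightarrow> str_less (Or E\<^sub>1 E\<^sub>2) (Two s) (Two s')"
| "str_less E s s' \<Longrightarrow> str_less (Rwd (Const c) E) s s'"

definition maximizing :: "('b, 'c, 'f, 'r :: {comm_monoid_add, linorder}, 'x) interp
    \<Rightarrow> ('b, 'c, 'f) tm \<Rightarrow> strategy \<Rightarrow> bool" where
  "maximizing I E s \<longleftrightarrow> s \<in> Str E \<and> (\<forall>t \<in> Str E. Rew I t E \<le> Rew I s E)"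

definition argmax :: "('b, 'c, 'f, 'r :: {comm_monoid_add, linorder}, 'x) interp
    \<Rightarrow> ('b, 'c, 'f) tm \<Rightarrow> strategy" where
  "argmax I E =
     (THE s. maximizing I E s \<and> (\<forall>t. maximizing I E t \<longrightarrow> t = s \<or> str_less E s t))"

definition Op_s :: "('b, 'c, 'f) language
    \<Rightarrow> ('b, 'c, 'f, 'r :: {comm_monoid_add, linorder}, 'x) interp
    \<Rightarrow> ('b, 'c, 'f) tm \<Rightarrow> 'r \<times> ('b, 'c, 'f) tm" where
  "Op_s L I M = Out I (argmax I (Op L M)) (Op L M)"

definition Ob_v :: "('b, 'c, 'f) language
    \<Rightarrow> ('b, 'c, 'f, 'r :: {comm_monoid_add, linorder}, 'x) interp
    \<Rightarrow> ('b, 'c, 'f) tm \<Rightarrow> ('b, 'c, 'f) tm" where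
  "Ob_v L I M = snd (Op_s L I M)"

end

theory Submission
  imports Defs
begin

text \<open>
  Observing the value already determines the reward. If \<open>P\<close> and \<open>Q\<close> both yield the value \<open>V\<close> with
  rewards \<open>r < s\<close>, then \<open>r\<close> is the denotation of some constant \<open>c\<close>, because those are closed
  under addition. With \<open>W\<close> the other truth value, the context \<open>(c \<cdot> W) or [ ]\<close> yields \<open>W\<close> on \<open>P\<close>,
  as ties go to the left, and \<open>V\<close> on \<open>Q\<close>. This needs \<open>Op\<close> to be total and single-valued on
  programs: totality is a Tait-style reducibility argument, uniqueness follows from unique
  decomposition into an evaluation context and a redex.
\<close>

section \<open>Determinism of evaluation\<close>

text \<open>Purely syntactic. Choices and rewards are counted as redexes besides the left-hand sides
  of \<open>red\<close>, so that one decomposition result covers every non-value rule of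
  \<open>op_rel\<close>.\<close>

inductive redex :: "('b, 'c, 'f) tm \<Rightarrow> bool" where
  "redex (FApp f (map Const cs))"
| "redex (Ite (Const c) M N)"
| "is_val V \<Longrightarrow> is_val W \<Longrightarrow> redex (Fst (Tup V W))"
| "is_val V \<Longrightarrow> is_val W \<Longrightarrow> redex (Snd (Tup V W))"
| "is_val V \<Longrightarrow> redex (App (Lam \<sigma> M) V)"
| "redex (Or M N)"
| "redex (Rwd (Const c) M)"

inductive_simps is_val_simps [simp]:
  "is_val (Var i)" "is_val (Const c)" "is_val (FApp f Ms)" "is_val (Ite B M N)" "is_val (Or M N)"
  "is_val (Rwd M N)" "is_val Star" "is_val (Tup M N)" "is_val (Fst M)" "is_val (Snd M)"
  "is_val (Lam \<sigma> M)" "is_val (App M N)"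

inductive_simps redex_simps:
  "redex (Const c)" "redex (FApp f Ms)" "redex (Ite B M N)" "redex (Or M N)"
  "redex (Rwd M N)" "redex (Tup M N)" "redex (Fst M)" "redex (Snd M)"
  "redex (Lam \<sigma> M)" "redex (App M N)"

lemma redex_not_val: "redex Q \<Longrightarrow> \<not> is_val Q"
  by (induction rule: redex.induct) auto

lemma fill_not_val: "eval_ctx C \<Longrightarrow> redex Q \<Longrightarrow> \<not> is_val (fill C Q)"
  by (induction rule: eval_ctx.induct) (auto dest: redex_not_val)

lemma fill_not_val_eqs:
  assumes "eval_ctx C" "redex Q"
  shows "fill C Q \<noteq> Const c" "fill C Q \<noteq> Lam \<sigma> M" "is_val V \<Longrightarrow> fill C Q \<noteq> V"
  using fill_not_val[OF assms] by (metis is_val.intros)+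

lemma fill_not_in_consts:
  assumes "eval_ctx C" "redex Q"
  shows "map Const cs \<noteq> Ms @ fill C Q # Ns"
proof
  assume "map Const cs = Ms @ fill C Q # Ns"
  then have "fill C Q \<in> set (map Const cs)" by simp
  then show False using fill_not_val[OF assms] by auto
qed

text \<open>The immediate subterms of a redex that lie in evaluation position are values, whereas a
  context filled with a redex is never a value. So no evaluation context can reach inside a
  redex.\<close>

lemma redex_fill:
  "eval_ctx C \<Longrightarrow> redex Q \<Longrightarrow> redex (fill C Q) \<Longrightarrow> C = Hole"
  by (cases rule: eval_ctx.cases)
    (auto simp: redex_simps fill_not_in_consts fill_not_val_eqs
        dest: fill_not_in_consts[THEN not_sym] fill_not_val)

text \<open>\<open>X\<close> and \<open>Y\<close> are each the first non-value of the same list, so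
  they occur at the same position. This fixes which argument of a function symbol is being
  evaluated.\<close>

lemma prefix_of_consts_unique:
  assumes "map Const cs @ X # Ms = map Const ds @ Y # Ns" "\<not> is_val X" "\<not> is_val Y"
  shows "cs = ds \<and> X = Y \<and> Ms = Ns"
  using assms
proof (induction cs arbitrary: ds)
  case Nil
  then show ?case by (cases ds) auto
next
  case (Cons c cs)
  then show ?case by (cases ds) auto
qed

text \<open>Induction on \<open>C\<close>. If one context is the hole, so is the other by
  \<open>redex_fill\<close>. Otherwise both must descend into the same subterm: whichever context
  has gone further treats the earlier subterms as values, and these cannot contain the other redex
  in evaluation position.\<close>

lemma unique_decomposition:
  assumes "eval_ctx C" "eval_ctx D" "redex Q" "redex R" "fill C Q = fill D R"
  shows "C = D \<and> Q = R"
  using assms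
proof (induction arbitrary: D rule: eval_ctx.induct)
  case 1
  then have "D = Hole" using redex_fill by fastforce
  with 1 show ?case by simp
next
  case (2 C f cs Ms)
  have "D \<noteq> Hole" using redex_fill[OF eval_ctx.intros(2)[OF 2(1)] 2(4)] 2(5,6) by auto
  with 2(3) show ?case
  proof (cases rule: eval_ctx.cases)
    case (2 C' g ds Ns)
    then show ?thesis
      using prefix_of_consts_unique[of cs "fill C Q" Ms ds "fill C' R" Ns]
        fill_not_val[OF \<open>eval_ctx C\<close> \<open>redex Q\<close>] fill_not_val[OF 2(2) \<open>redex R\<close>] "2.IH" "2.prems"
      by auto
  qed (use 2(6) in auto)
next
  case (3 C M N)
  have "D \<noteq> Hole" using redex_fill[OF eval_ctx.intros(3)[OF 3(1)] 3(4)] 3(5,6) by auto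
  with 3(3) show ?case
    by (cases rule: eval_ctx.cases)
      (use 3(6) 3(2)[OF _ 3(4,5)] fill_not_val[OF 3(1,4)] fill_not_val[OF _ 3(5)] in auto)
next
  case (4 C M)
  have "D \<noteq> Hole" using redex_fill[OF eval_ctx.intros(4)[OF 4(1)] 4(4)] 4(5,6) by auto
  with 4(3) show ?case
    by (cases rule: eval_ctx.cases)
      (use 4(6) 4(2)[OF _ 4(4,5)] fill_not_val[OF 4(1,4)] fill_not_val[OF _ 4(5)] in auto)
next
  case (5 C N)
  have "D \<noteq> Hole" using redex_fill[OF eval_ctx.intros(5)[OF 5(1)] 5(4)] 5(5,6) by auto
  with 5(3) show ?case
    by (cases rule: eval_ctx.cases)
      (use 5(6) 5(2)[OF _ 5(4,5)] fill_not_val[OF 5(1,4)] fill_not_val[OF _ 5(5)] in auto)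
next
  case (6 V C)
  have "D \<noteq> Hole" using redex_fill[OF eval_ctx.intros(6)[OF 6(1,2)] 6(5)] 6(6,7) by auto
  with 6(4) show ?case
    by (cases rule: eval_ctx.cases)
      (use 6(1,7) 6(3)[OF _ 6(5,6)] fill_not_val[OF 6(2,5)] fill_not_val[OF _ 6(6)] in auto)
next
  case (7 C)
  have "D \<noteq> Hole" using redex_fill[OF eval_ctx.intros(7)[OF 7(1)] 7(4)] 7(5,6) by auto
  with 7(3) show ?case
    by (cases rule: eval_ctx.cases)
      (use 7(6) 7(2)[OF _ 7(4,5)] fill_not_val[OF 7(1,4)] fill_not_val[OF _ 7(5)] in auto)
next
  case (8 C)
  have "D \<noteq> Hole" using redex_fill[OF eval_ctx.intros(8)[OF 8(1)] 8(4)] 8(5,6) by auto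
  with 8(3) show ?case
    by (cases rule: eval_ctx.cases)
      (use 8(6) 8(2)[OF _ 8(4,5)] fill_not_val[OF 8(1,4)] fill_not_val[OF _ 8(5)] in auto)
next
  case (9 C N)
  have "D \<noteq> Hole" using redex_fill[OF eval_ctx.intros(9)[OF 9(1)] 9(4)] 9(5,6) by auto
  with 9(3) show ?case
    by (cases rule: eval_ctx.cases)
      (use 9(6) 9(2)[OF _ 9(4,5)] fill_not_val[OF 9(1,4)] fill_not_val[OF _ 9(5)] in auto)
next
  case (10 C \<sigma> M)
  have "D \<noteq> Hole" using redex_fill[OF eval_ctx.intros(10)[OF 10(1)] 10(4)] 10(5,6) by auto
  with 10(3) show ?case
  proof (cases rule: eval_ctx.cases)
    case (9 C' N)
    \<comment> \<open>The other context evaluates the operator of the application, but the operator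
      is already an abstraction.\<close>
    then have "fill C' R = Lam \<sigma> M" using "10.prems"(4) by simp
    then show ?thesis using fill_not_val_eqs(2)[OF 9(2) 10(5)] by blast
  next
    case (10 C' \<tau> N)
    then show ?thesis using "10.IH"[OF _ "10.prems"(2,3)] "10.prems"(4) by simp
  qed (use 10(6) in auto)
qed

section \<open>Determinism of reduction and of effect values\<close>

lemma red_redex: "red L Q Q' \<Longrightarrow> redex Q"
  by (induction rule: red.induct) (auto intro: redex.intros)

inductive_simps red_simps:
  "red L (FApp f Ms) Q" "red L (Ite B M N) Q" "red L (Fst M) Q" "red L (Snd M) Q" "red L (App M N) Q"
  "red L (Or M N) Q" "red L (Rwd M N) Q"

lemma map_Const_eq_iff: "map Const cs = map Const ds \<longleftrightarrow> cs = ds"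
  by (simp add: inj_map_eq_map inj_def)

text \<open>Only the two conditional rules could overlap, and they do not because
  \<open>tt L\<close> and \<open>ff L\<close> differ.\<close>

lemma red_deterministic:
  assumes "red L Q Q1" "red L Q Q2" "tt L \<noteq> ff L"
  shows "Q1 = Q2"
  using assms(1)
  by (cases rule: red.cases) (use assms(2,3) in \<open>auto simp: red_simps map_Const_eq_iff\<close>)

lemma not_step_val: "step L M M' \<Longrightarrow> \<not> is_val M"
  by (auto elim!: step.cases dest: red_redex fill_not_val)

lemma not_red_Or: "\<not> red L (Or M N) Q" and not_red_Rwd: "\<not> red L (Rwd M N) Q"
  by (simp_all add: red_simps)

lemma step_fill:
  assumes "step L (fill C Q) X" "eval_ctx C" "redex Q"
  shows "\<exists>Q'. red L Q Q' \<and> X = fill C Q'"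
  using assms(1)
proof (cases rule: step.cases)
  case (1 D R R')
  then have "C = D \<and> Q = R"
    using unique_decomposition[OF assms(2) 1(3) assms(3) red_redex[OF 1(4)]] by simp
  then show ?thesis using 1(2,4) by blast
qed

text \<open>By unique decomposition the redex in evaluation position dictates the rule: a choice, a
  reward, an ordinary reduction, or none at all for a value. The induction hypotheses then compare
  the subderivations.\<close>

lemma op_rel_deterministic:
  assumes "op_rel L M E" "op_rel L M E'" "tt L \<noteq> ff L"
  shows "E = E'"
  using assms(1,2)
proof (induction arbitrary: E' rule: op_rel.induct)
  case (1 V)
  note V = \<open>is_val V\<close>
  from 1(2) show ?case
  proof (cases rule: op_rel.cases)
    case (2 X)
    then show ?thesis using V not_step_val by blast
  next
    case (3 D M1 E1 M2 E2)
    then show ?thesis using V fill_not_val[OF 3(3) redex.intros(6)] by simp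
  next
    case (4 D M E c)
    then show ?thesis using V fill_not_val[OF 4(3) redex.intros(7)] by simp
  qed simp
next
  case (2 M M' E)
  from 2(1) obtain C Q Q' where M: "M = fill C Q" "M' = fill C Q'" "eval_ctx C" "red L Q Q'"
    by (auto elim: step.cases)
  from 2(4) show ?case
  proof (cases rule: op_rel.cases)
    case 1
    then show ?thesis using 2(1) not_step_val by blast
  next
    case (2 X)
    then obtain R where "red L Q R" "X = fill C R"
      using step_fill[OF _ M(3) red_redex[OF M(4)]] M(1) by blast
    then have "X = M'" using red_deterministic[OF M(4) _ assms(3)] M(2) by blast
    then show ?thesis using 2 "2.IH" by blast
  next
    case (3 D M1 E1 M2 E2)
    then have "Q = Or M1 M2"
      using M(1) unique_decomposition[OF M(3) 3(3) red_redex[OF M(4)] redex.intros(6)] by simp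
    then show ?thesis using M(4) not_red_Or by blast
  next
    case (4 D M E c)
    then have "Q = Rwd (Const c) M"
      using M(1) unique_decomposition[OF M(3) 4(3) red_redex[OF M(4)] redex.intros(7)] by simp
    then show ?thesis using M(4) not_red_Rwd by blast
  qed
next
  case (3 C M1 E1 M2 E2)
  have rx: "redex (Or M1 M2)" by (rule redex.intros)
  from 3(6) show ?case
  proof (cases rule: op_rel.cases)
    case 1
    then show ?thesis using fill_not_val[OF 3(1) rx] by simp
  next
    case (2 X)
    then show ?thesis using step_fill[of L C "Or M1 M2" X, OF _ \<open>eval_ctx C\<close> rx] not_red_Or by metis
  next
    case (3 D N1 F1 N2 F2)
    then have "C = D \<and> Or M1 M2 = Or N1 N2"
      using unique_decomposition[OF \<open>eval_ctx C\<close> 3(3) rx redex.intros(6) 3(1)] by simp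
    then show ?thesis using 3 "3.IH" by auto
  next
    case (4 D N F c)
    then show ?thesis
      using unique_decomposition[OF \<open>eval_ctx C\<close> 4(3) rx redex.intros(7) 4(1)] by simp
  qed
next
  case (4 C M E c)
  have rx: "redex (Rwd (Const c) M)" by (rule redex.intros)
  from 4(4) show ?case
  proof (cases rule: op_rel.cases)
    case 1
    then show ?thesis using fill_not_val[OF 4(1) rx] by simp
  next
    case (2 X)
    then show ?thesis using step_fill[of L C "Rwd (Const c) M" X, OF _ \<open>eval_ctx C\<close> rx] not_red_Rwd by metis
  next
    case (3 D N1 F1 N2 F2)
    then show ?thesis
      using unique_decomposition[OF \<open>eval_ctx C\<close> 3(3) rx redex.intros(6) 3(1)] by simp
  next
    case (4 D N F d)
    then have "C = D \<and> Rwd (Const c) M = Rwd (Const d) N"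
      using unique_decomposition[OF \<open>eval_ctx C\<close> 4(3) rx redex.intros(7) 4(1)] by simp
    then show ?thesis using 4 "4.IH" by auto
  qed
qed

lemma Op_eqI: "op_rel L M E \<Longrightarrow> tt L \<noteq> ff L \<Longrightarrow> Op L M = E"
  unfolding Op_def using op_rel_deterministic by blast

section \<open>Termination of evaluation\<close>

text \<open>The effect values whose leaves all satisfy \<open>P\<close>, with well-typed reward
  constants. The parameter lets one definition carry reducibility of leaves through
  evaluation.\<close>

inductive effect_value ::
  "('b, 'c, 'f) language \<Rightarrow> (('b, 'c, 'f) tm \<Rightarrow> bool) \<Rightarrow> ('b, 'c, 'f) tm \<Rightarrow> bool"
  for L P where
  "is_val V \<Longrightarrow> P V \<Longrightarrow> effect_value L P V"
| "effect_value L P E\<^sub>1 \<Longrightarrow> effect_value L P E\<^sub>2 \<Longrightarrow> effect_value L P (Or E\<^sub>1 E\<^sub>2)"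
| "const_type L c = rew_base L \<Longrightarrow> effect_value L P E \<Longrightarrow> effect_value L P (Rwd (Const c) E)"

inductive_cases effect_value_OrE: "effect_value L P (Or M N)"
inductive_cases effect_value_RwdE: "effect_value L P (Rwd M N)"

text \<open>Lifts a predicate on values to terms, as the expression level of Tait's method
  does.\<close>

definition evaluates ::
  "('b, 'c, 'f) language \<Rightarrow> (('b, 'c, 'f) tm \<Rightarrow> bool) \<Rightarrow> ('b, 'c, 'f) tm \<Rightarrow> bool" where
  "evaluates L P M \<longleftrightarrow> (\<exists>E. op_rel L M E \<and> effect_value L P E)"

lemma evaluates_val: "is_val V \<Longrightarrow> P V \<Longrightarrow> evaluates L P V"
  unfolding evaluates_def by (meson op_rel.intros(1) effect_value.intros(1))

lemma evaluates_step: "step L M M' \<Longrightarrow> evaluates L P M' \<Longrightarrow> evaluates L P M"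
  unfolding evaluates_def by (meson op_rel.intros(2))

lemma evaluates_red: "red L M M' \<Longrightarrow> evaluates L P M' \<Longrightarrow> evaluates L P M"
  using evaluates_step step.intros[OF eval_ctx.intros(1)] by fastforce

lemma evaluates_Or:
  "eval_ctx C \<Longrightarrow> evaluates L P (fill C M) \<Longrightarrow> evaluates L P (fill C N) \<Longrightarrow>
    evaluates L P (fill C (Or M N))"
  unfolding evaluates_def by (meson op_rel.intros(3) effect_value.intros(2))

lemma evaluates_Rwd:
  "eval_ctx C \<Longrightarrow> const_type L c = rew_base L \<Longrightarrow> evaluates L P (fill C M) \<Longrightarrow>
    evaluates L P (fill C (Rwd (Const c) M))"
  unfolding evaluates_def by (meson op_rel.intros(4) effect_value.intros(3))

lemma eval_ctx_compose:
  "eval_ctx C \<Longrightarrow> eval_ctx D \<Longrightarrow> \<exists>F. eval_ctx F \<and> (\<forall>X. fill F X = fill C (fill D X))"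
proof (induction rule: eval_ctx.induct)
  case (1)
  then show ?case by auto
qed (use eval_ctx.intros fill.simps in metis)+

text \<open>The derivation for \<open>M\<close> is replayed inside \<open>C\<close>: each rule used
  in a context \<open>D\<close> is used in the composite of \<open>C\<close> and \<open>D\<close>,
  and at a leaf the evaluation continues from \<open>fill C V\<close>.\<close>

lemma evaluates_bind:
  assumes "evaluates L P M" "eval_ctx C"
    and "\<And>V. is_val V \<Longrightarrow> P V \<Longrightarrow> evaluates L Q (fill C V)"
  shows "evaluates L Q (fill C M)"
proof -
  from assms(1) obtain E where "op_rel L M E" "effect_value L P E"
    unfolding evaluates_def by blast
  then show ?thesis
  proof (induction rule: op_rel.induct)
    case (1 V)
    then show ?case using assms(3) by (auto elim: effect_value.cases)
  next
    case (2 M M' E)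
    from 2(1) obtain D R R' where D: "M = fill D R" "M' = fill D R'" "eval_ctx D" "red L R R'"
      by (auto elim: step.cases)
    from eval_ctx_compose[OF assms(2) D(3)] obtain F
      where F: "eval_ctx F" "\<forall>X. fill F X = fill C (fill D X)" by blast
    then have "step L (fill C M) (fill C M')" using step.intros[OF F(1) D(4)] D by simp
    then show ?case using 2 evaluates_step by blast
  next
    case (3 D M1 E1 M2 E2)
    from eval_ctx_compose[OF assms(2) 3(1)] obtain F
      where F: "eval_ctx F" "\<forall>X. fill F X = fill C (fill D X)" by blast
    then show ?case using 3 evaluates_Or[OF F(1)] by (auto elim: effect_value_OrE)
  next
    case (4 D M E c)
    from eval_ctx_compose[OF assms(2) 4(1)] obtain F
      where F: "eval_ctx F" "\<forall>X. fill F X = fill C (fill D X)" by blast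
    then show ?case using 4 evaluates_Rwd[OF F(1)] by (auto elim: effect_value_RwdE)
  qed
qed

section \<open>Closed terms and simultaneous substitution\<close>

definition closed_tm :: "('b, 'c, 'f) tm \<Rightarrow> bool" where
  "closed_tm M \<longleftrightarrow> (\<forall>k W. subst k W M = M)"

text \<open>As in \<open>subst\<close>, the substituted terms are meant to be closed and are not shifted.\<close>

fun msubst :: "nat \<Rightarrow> ('b, 'c, 'f) tm list \<Rightarrow> ('b, 'c, 'f) tm \<Rightarrow> ('b, 'c, 'f) tm" where
  "msubst k Vs (Var i) = (if i < k then Var i else if i < k + length Vs then Vs ! (i - k)
     else Var (i - length Vs))"
| "msubst k Vs (Const c) = Const c"
| "msubst k Vs (FApp f Ms) = FApp f (map (msubst k Vs) Ms)"
| "msubst k Vs (Ite B M N) = Ite (msubst k Vs B) (msubst k Vs M) (msubst k Vs N)"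
| "msubst k Vs (Or M N) = Or (msubst k Vs M) (msubst k Vs N)"
| "msubst k Vs (Rwd N M) = Rwd (msubst k Vs N) (msubst k Vs M)"
| "msubst k Vs Star = Star"
| "msubst k Vs (Tup M N) = Tup (msubst k Vs M) (msubst k Vs N)"
| "msubst k Vs (Fst M) = Fst (msubst k Vs M)"
| "msubst k Vs (Snd M) = Snd (msubst k Vs M)"
| "msubst k Vs (Lam \<sigma> M) = Lam \<sigma> (msubst (Suc k) Vs M)"
| "msubst k Vs (App M N) = App (msubst k Vs M) (msubst k Vs N)"

lemma msubst_Nil: "msubst k [] M = M"
  by (induction M arbitrary: k) (auto intro: map_idI)

text \<open>Turns the result of a beta step on a substituted abstraction into the body under the
  environment extended by the argument. The entries of \<open>Vs\<close> are closed, so the later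
  substitution leaves them alone.\<close>

lemma subst_msubst:
  "(\<And>V. V \<in> set Vs \<Longrightarrow> closed_tm V) \<Longrightarrow> subst k W (msubst (Suc k) Vs M) = msubst k (W # Vs) M"
proof (induction M arbitrary: k)
  case (Var i)
  consider "i < k" | "i = k" | "k < i" "i < Suc k + length Vs" | "Suc k + length Vs \<le> i"
    by linarith
  then show ?case
  proof cases
    case 3
    then have "Vs ! (i - Suc k) \<in> set Vs" by (intro nth_mem) linarith
    then have "subst k W (Vs ! (i - Suc k)) = Vs ! (i - Suc k)"
      using Var by (simp add: closed_tm_def)
    with 3 show ?thesis by (simp add: nth_Cons')
  qed auto
qed auto

text \<open>All indices from \<open>k\<close> on have been replaced by closed terms, so nothing is
  left at or above \<open>j\<close>.\<close>

lemma subst_msubst_typed: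
  assumes "typing L \<Gamma> M \<tau>" "length \<Gamma> \<le> k + length Vs" "\<And>V. V \<in> set Vs \<Longrightarrow> closed_tm V" "k \<le> j"
  shows "subst j W (msubst k Vs M) = msubst k Vs M"
  using assms
proof (induction arbitrary: k j rule: typing.induct)
  case (T_Var i \<Gamma>)
  show ?case
  proof (cases "i < k")
    case True
    then show ?thesis using T_Var by simp
  next
    case False
    with T_Var have "Vs ! (i - k) \<in> set Vs" "i < k + length Vs" by auto
    with False T_Var show ?thesis by (simp add: closed_tm_def)
  qed
next
  case (T_FApp \<Gamma> Ms f)
  then have "\<forall>M \<in> set Ms. subst j W (msubst k Vs M) = msubst k Vs M"
    by (auto simp: list_all2_conv_all_nth in_set_conv_nth)
  then show ?case by simp
qed auto

text \<open>The logical relation on values. At function types closedness is demanded explicitly,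
  since the body of an abstraction could mention outer variables; at the other types it follows by
  induction.\<close>

primrec reducible ::
  "('b, 'c, 'f) language \<Rightarrow> 'b ty \<Rightarrow> ('b, 'c, 'f) tm \<Rightarrow> bool" where
  "reducible L (Base b) V \<longleftrightarrow> (\<exists>c. V = Const c \<and> const_type L c = b)"
| "reducible L UnitT V \<longleftrightarrow> V = Star"
| "reducible L (ProdT \<sigma> \<tau>) V \<longleftrightarrow> (\<exists>V\<^sub>1 V\<^sub>2. V = Tup V\<^sub>1 V\<^sub>2 \<and> reducible L \<sigma> V\<^sub>1 \<and> reducible L \<tau> V\<^sub>2)"
| "reducible L (FunT \<sigma> \<tau>) V \<longleftrightarrow> closed_tm V \<and>
     (\<exists>\<rho> M. V = Lam \<rho> M \<and> (\<forall>W. reducible L \<sigma> W \<longrightarrow> evaluates L (reducible L \<tau>) (subst 0 W M)))"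

lemma reducible_is_val: "reducible L \<sigma> V \<Longrightarrow> is_val V"
  by (induction \<sigma> arbitrary: V) auto

lemma reducible_closed: "reducible L \<sigma> V \<Longrightarrow> closed_tm V"
  by (induction \<sigma> arbitrary: V) (fastforce simp: closed_tm_def)+

declare reducible.simps [simp del]

section \<open>The fundamental lemma of reducibility\<close>

context selection_language
begin

text \<open>\<open>cs\<close> collects the arguments already evaluated. Each induction step
  evaluates the next one and appends its constant; when none remain, the function symbol is
  applied.\<close>

lemma evaluates_FApp:
  assumes "list_all2 (\<lambda>M b. evaluates L (reducible L (Base b)) M) Ms bs"
    and "map (const_type L) cs @ bs = arg_types L f"
  shows "evaluates L (reducible L (Base (res_type L f))) (FApp f (map Const cs @ Ms))"
  using assms
proof (induction Ms bs arbitrary: cs rule: list_all2_induct)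
  case Nil
  then have args: "map (const_type L) cs = arg_types L f" by simp
  then have "evaluates L (reducible L (Base (res_type L f))) (Const (val L f cs))"
    by (intro evaluates_val) (simp_all add: val_type reducible.simps)
  then show ?case using evaluates_red[OF red.intros(1)[OF args]] by simp
next
  case (Cons M Ms b bs)
  have "evaluates L (reducible L (Base (res_type L f)))
      (fill (CFApp f (map Const cs) Hole Ms) M)"
  proof (rule evaluates_bind[OF Cons(1)])
    show "eval_ctx (CFApp f (map Const cs) Hole Ms)" by (intro eval_ctx.intros)
  next
    fix V assume "reducible L (Base b) V"
    then obtain c where "V = Const c" "const_type L c = b" by (auto simp: reducible.simps)
    then show "evaluates L (reducible L (Base (res_type L f)))
        (fill (CFApp f (map Const cs) Hole Ms) V)"
      using Cons(3)[of "cs @ [c]"] Cons(4) by simp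
  qed
  then show ?case by simp
qed

end

text \<open>Constants of one type embed into its denotation, which here has two elements. Hence
  conditionals never get stuck.\<close>

lemma (in selection_model) bool_const: "const_type L c = bool_base L \<Longrightarrow> c = tt L \<or> c = ff L"
  by (metis (full_types) base_bool const_distinct const_ff const_in const_tt ff_type rangeE tt_type)

lemma (in selection_model) tt_neq_ff: "tt L \<noteq> ff L"
  using const_tt const_ff by auto

text \<open>The fundamental lemma: induction on typing, with free variables replaced by reducible
  values. Compound terms are handled by binding their subterms in evaluation order.\<close>

lemma (in selection_model) typing_evaluates:
  assumes "typing L \<Gamma> M \<sigma>" "list_all2 (reducible L) \<Gamma> Vs"
  shows "evaluates L (reducible L \<sigma>) (msubst 0 Vs M)"
  using assms
proof (induction arbitrary: Vs rule: typing.induct)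
  case (T_Var i \<Gamma>)
  then have "reducible L (\<Gamma> ! i) (Vs ! i)" "i < length Vs"
    by (auto simp: list_all2_conv_all_nth)
  then show ?case by (auto intro: evaluates_val reducible_is_val)
next
  case (T_Const \<Gamma> c)
  then show ?case by (auto intro!: evaluates_val simp: reducible.simps)
next
  case (T_FApp \<Gamma> Ms f)
  then have "list_all2 (\<lambda>M b. evaluates L (reducible L (Base b)) M)
      (map (msubst 0 Vs) Ms) (arg_types L f)"
    by (auto simp: list_all2_conv_all_nth)
  from evaluates_FApp[OF this, of "[]" f] show ?case by simp
next
  case (T_Ite \<Gamma> B M \<sigma> N)
  have "evaluates L (reducible L \<sigma>)
      (fill (CIte1 Hole (msubst 0 Vs M) (msubst 0 Vs N)) (msubst 0 Vs B))"
  proof (rule evaluates_bind[OF T_Ite.IH(1)[OF T_Ite.prems]])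
    fix V assume "reducible L (Base (bool_base L)) V"
    then consider "V = Const (tt L)" | "V = Const (ff L)"
      using bool_const by (auto simp: reducible.simps)
    then show "evaluates L (reducible L \<sigma>) (fill (CIte1 Hole (msubst 0 Vs M) (msubst 0 Vs N)) V)"
      using evaluates_red[OF red.intros(2) T_Ite.IH(2)[OF T_Ite.prems]]
        evaluates_red[OF red.intros(3) T_Ite.IH(3)[OF T_Ite.prems]]
      by cases simp_all
  qed (intro eval_ctx.intros)
  then show ?case by simp
next
  case (T_Or \<Gamma> M \<sigma> N)
  show ?case
    using evaluates_Or[OF eval_ctx.intros(1), of L _ "msubst 0 Vs M" "msubst 0 Vs N"]
      T_Or.IH[OF T_Or.prems] by simp
next
  case (T_Rwd \<Gamma> N M \<sigma>)
  have "evaluates L (reducible L \<sigma>) (fill (CRwd1 Hole (msubst 0 Vs M)) (msubst 0 Vs N))"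
  proof (rule evaluates_bind[OF T_Rwd.IH(1)[OF T_Rwd.prems]])
    fix V assume "reducible L (Base (rew_base L)) V"
    then obtain c where "V = Const c" "const_type L c = rew_base L"
      by (auto simp: reducible.simps)
    then show "evaluates L (reducible L \<sigma>) (fill (CRwd1 Hole (msubst 0 Vs M)) V)"
      using evaluates_Rwd[OF eval_ctx.intros(1)] T_Rwd.IH(2)[OF T_Rwd.prems] by simp
  qed (intro eval_ctx.intros)
  then show ?case by simp
next
  case (T_Star \<Gamma>)
  then show ?case by (auto intro!: evaluates_val simp: reducible.simps)
next
  case (T_Tup \<Gamma> M \<sigma> N \<tau>)
  have "evaluates L (reducible L (ProdT \<sigma> \<tau>)) (fill (CTup1 Hole (msubst 0 Vs N)) (msubst 0 Vs M))"
  proof (rule evaluates_bind[OF T_Tup.IH(1)[OF T_Tup.prems]])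
    fix V assume V: "is_val V" "reducible L \<sigma> V"
    have "evaluates L (reducible L (ProdT \<sigma> \<tau>)) (fill (CTup2 V Hole) (msubst 0 Vs N))"
    proof (rule evaluates_bind[OF T_Tup.IH(2)[OF T_Tup.prems]])
      fix W assume "is_val W" "reducible L \<tau> W"
      with V show "evaluates L (reducible L (ProdT \<sigma> \<tau>)) (fill (CTup2 V Hole) W)"
        by (auto intro!: evaluates_val simp: reducible.simps)
    qed (intro eval_ctx.intros V(1))
    then show "evaluates L (reducible L (ProdT \<sigma> \<tau>)) (fill (CTup1 Hole (msubst 0 Vs N)) V)"
      by simp
  qed (intro eval_ctx.intros)
  then show ?case by simp
next
  case (T_Fst \<Gamma> M \<sigma> \<tau>)
  have "evaluates L (reducible L \<sigma>) (fill (CFst Hole) (msubst 0 Vs M))"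
  proof (rule evaluates_bind[OF T_Fst.IH[OF T_Fst.prems]])
    fix V assume "is_val V" "reducible L (ProdT \<sigma> \<tau>) V"
    then show "evaluates L (reducible L \<sigma>) (fill (CFst Hole) V)"
      by (auto simp: reducible.simps intro!: evaluates_red[OF red.intros(4) evaluates_val])
  qed (intro eval_ctx.intros)
  then show ?case by simp
next
  case (T_Snd \<Gamma> M \<sigma> \<tau>)
  have "evaluates L (reducible L \<tau>) (fill (CSnd Hole) (msubst 0 Vs M))"
  proof (rule evaluates_bind[OF T_Snd.IH[OF T_Snd.prems]])
    fix V assume "is_val V" "reducible L (ProdT \<sigma> \<tau>) V"
    then show "evaluates L (reducible L \<tau>) (fill (CSnd Hole) V)"
      by (auto simp: reducible.simps intro!: evaluates_red[OF red.intros(5) evaluates_val])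
  qed (intro eval_ctx.intros)
  then show ?case by simp
next
  case (T_Lam \<sigma> \<Gamma> M \<tau>)
  have cl: "\<And>V. V \<in> set Vs \<Longrightarrow> closed_tm V"
    using T_Lam.prems by (auto simp: list_all2_conv_all_nth in_set_conv_nth intro: reducible_closed)
  \<comment> \<open>The environment covers all of the body's variables except index 0, which the
    abstraction binds.\<close>
  have "closed_tm (Lam \<sigma> (msubst (Suc 0) Vs M))"
    using subst_msubst_typed[OF T_Lam.hyps] cl list_all2_lengthD[OF T_Lam.prems]
    by (simp add: closed_tm_def)
  moreover have "evaluates L (reducible L \<tau>) (subst 0 W (msubst (Suc 0) Vs M))"
    if "reducible L \<sigma> W" for W
    using T_Lam.IH[of "W # Vs"] T_Lam.prems that subst_msubst[OF cl, of Vs 0 W M] by simp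
  ultimately show ?case by (auto intro!: evaluates_val simp: reducible.simps)
next
  case (T_App \<Gamma> M \<sigma> \<tau> N)
  have "evaluates L (reducible L \<tau>) (fill (CApp1 Hole (msubst 0 Vs N)) (msubst 0 Vs M))"
  proof (rule evaluates_bind[OF T_App.IH(1)[OF T_App.prems]])
    fix V assume "reducible L (FunT \<sigma> \<tau>) V"
    then obtain \<rho> M' where M': "V = Lam \<rho> M'"
      "\<And>W. reducible L \<sigma> W \<Longrightarrow> evaluates L (reducible L \<tau>) (subst 0 W M')"
      by (auto simp: reducible.simps)
    have "evaluates L (reducible L \<tau>) (fill (CApp2 (Lam \<rho> M') Hole) (msubst 0 Vs N))"
    proof (rule evaluates_bind[OF T_App.IH(2)[OF T_App.prems]])
      fix W assume "is_val W" "reducible L \<sigma> W"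
      then show "evaluates L (reducible L \<tau>) (fill (CApp2 (Lam \<rho> M') Hole) W)"
        using evaluates_red[OF red.intros(6) M'(2)] by simp
    qed (intro eval_ctx.intros)
    then show "evaluates L (reducible L \<tau>) (fill (CApp1 Hole (msubst 0 Vs N)) V)"
      by (simp add: M'(1))
  qed (intro eval_ctx.intros)
  then show ?case by simp
qed

section \<open>The selected outcome\<close>

context selection_model
begin

lemma program_op_rel:
  assumes "program L M \<sigma>"
  shows "op_rel L M (Op L M)" "effect_value L (reducible L \<sigma>) (Op L M)"
proof -
  have "evaluates L (reducible L \<sigma>) M"
    using typing_evaluates[of "[]" M \<sigma> "[]"] assms by (simp add: program_def msubst_Nil)
  then obtain E where E: "op_rel L M E" "effect_value L (reducible L \<sigma>) E"
    unfolding evaluates_def by blast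
  moreover have "Op L M = E" using Op_eqI E(1) tt_neq_ff by blast
  ultimately show "op_rel L M (Op L M)" "effect_value L (reducible L \<sigma>) (Op L M)" by simp_all
qed

text \<open>A recursive description of \<open>argmax\<close>. The strict comparison resolves ties to
  the left, in accordance with the strategy order.\<close>

fun best :: "('b, 'c, 'f) tm \<Rightarrow> strategy" where
  "best (Or E\<^sub>1 E\<^sub>2) =
     (if fst (Out I (best E\<^sub>1) E\<^sub>1) < fst (Out I (best E\<^sub>2) E\<^sub>2) then Two (best E\<^sub>2) else One (best E\<^sub>1))"
| "best (Rwd N E) = best E"
| "best V = Stop"

lemma val_simps:
  assumes "is_val V"
  shows "Str V = {Stop}" "Out I Stop V = (0, V)" "best V = Stop"
  using assms by (cases V; simp)+

lemma add_left_le_iff: "t + r \<le> t + s \<longleftrightarrow> r \<le> (s :: 'r)"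
  using add_le_iff[of r s t] by (simp add: add.commute)

lemma best_maximizing: "effect_value L P E \<Longrightarrow> maximizing I E (best E)"
proof (induction rule: effect_value.induct)
  case (1 V)
  then show ?case by (simp add: maximizing_def val_simps)
next
  case (2 E1 E2)
  then show ?case by (fastforce simp: maximizing_def Rew_def)
next
  case (3 c E)
  then show ?case by (simp add: maximizing_def Rew_def case_prod_beta add_left_le_iff)
qed

lemma best_least:
  "effect_value L P E \<Longrightarrow> maximizing I E t \<Longrightarrow> t = best E \<or> str_less E (best E) t"
proof (induction arbitrary: t rule: effect_value.induct)
  case (1 V)
  then show ?case by (simp add: maximizing_def val_simps)
next
  case (2 E1 E2)
  have m: "maximizing I E1 (best E1)" "maximizing I E2 (best E2)"
    using best_maximizing 2 by blast+
  from 2(5) consider s where "t = One s" "s \<in> Str E1" | s where "t = Two s" "s \<in> Str E2"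
    by (auto simp: maximizing_def)
  then show ?case
  proof cases
    case (1 s)
    then have "maximizing I E1 s" using 2(5) by (auto simp: maximizing_def Rew_def ball_Un)
    moreover have "fst (Out I (best E2) E2) \<le> fst (Out I s E1)"
      using 1 2(5) m(2) by (auto simp: maximizing_def Rew_def ball_Un)
    \<comment> \<open>A left strategy attains the overall maximum, so the optimum on the right
      cannot exceed the one on the left and \<open>best\<close> goes left.\<close>
    then have "\<not> fst (Out I (best E1) E1) < fst (Out I (best E2) E2)"
      using 1 m(1) by (fastforce simp: maximizing_def Rew_def)
    ultimately show ?thesis using 2(3) 1 by (auto intro: str_less.intros)
  next
    case (2 s)
    then have "maximizing I E2 s" using \<open>maximizing I (Or E1 E2) t\<close>
      by (auto simp: maximizing_def Rew_def ball_Un)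
    then have "s = best E2 \<or> str_less E2 (best E2) s" using "2.IH"(2) by blast
    \<comment> \<open>If \<open>best\<close> goes left, it precedes every right strategy; the
      corresponding rule of \<open>str_less\<close> asks for membership.\<close>
    moreover have "best E1 \<in> Str E1" using m(1) by (simp add: maximizing_def)
    ultimately show ?thesis using 2 by (auto intro: str_less.intros)
  qed
next
  case (3 c E)
  then have "maximizing I E t"
    by (simp add: maximizing_def Rew_def case_prod_beta add_left_le_iff)
  then show ?case using 3 by (auto intro: str_less.intros)
qed

text \<open>Makes the least maximizing strategy unique, as the definite description in
  \<open>argmax\<close> requires.\<close>

lemma str_less_asym: "str_less E s t \<Longrightarrow> \<not> str_less E t s"
  by (induction rule: str_less.induct) (auto elim: str_less.cases)

lemma argmax_eq_best:
  assumes "effect_value L P E"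
  shows "argmax I E = best E"
  unfolding argmax_def
proof (rule the_equality)
  show "maximizing I E (best E) \<and>
      (\<forall>t. maximizing I E t \<longrightarrow> t = best E \<or> str_less E (best E) t)"
    using best_maximizing[OF assms] best_least[OF assms] by blast
next
  fix s assume "maximizing I E s \<and> (\<forall>t. maximizing I E t \<longrightarrow> t = s \<or> str_less E s t)"
  then show "s = best E"
    using best_maximizing[OF assms] best_least[OF assms] str_less_asym by blast
qed

lemma snd_Out_best: "effect_value L P E \<Longrightarrow> P (snd (Out I (best E) E))"
  by (induction rule: effect_value.induct) (auto simp: val_simps case_prod_beta)

lemma rew_const: "const_type L c = rew_base L \<Longrightarrow> \<exists>r. const_den I c = RewV r"
  using const_in[of c] base_rew by auto

text \<open>The reward along a branch is a finite sum of denoted constants, starting from 0 at the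
  leaf. Since \<open>val\<close> agrees with the addition of rewards, each partial sum is again
  denoted by a constant.\<close>

lemma fst_Out_best_const:
  "effect_value L P E \<Longrightarrow>
    \<exists>c. const_type L c = rew_base L \<and> const_den I c = RewV (fst (Out I (best E) E))"
proof (induction rule: effect_value.induct)
  case (1 V)
  then show ?case using zero_type const_zero by (auto simp: val_simps)
next
  case (2 E1 E2)
  then show ?case by auto
next
  case (3 c E)
  then obtain d where d: "const_type L d = rew_base L"
    "const_den I d = RewV (fst (Out I (best E) E))" by blast
  obtain r where r: "const_den I c = RewV r" using rew_const 3 by blast
  let ?e = "val L (plus_sym L) [c, d]"
  have "const_type L ?e = rew_base L"
    using val_type[of "[c, d]" "plus_sym L"] plus_type 3 d by simp
  moreover have "const_den I ?e = RewV (r + fst (Out I (best E) E))"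
    using fun_val[of "[c, d]" "plus_sym L"] plus_type 3 d r fun_plus by simp
  ultimately show ?case using r by (auto simp: case_prod_beta)
qed

section \<open>Selected outcomes of programs and separating contexts\<close>

lemma Op_s_eq: "program L M \<sigma> \<Longrightarrow> Op_s L I M = Out I (best (Op L M)) (Op L M)"
  using program_op_rel(2) argmax_eq_best by (fastforce simp: Op_s_def)

lemma Op_s_reducible: "program L M \<sigma> \<Longrightarrow> reducible L \<sigma> (snd (Op_s L I M))"
  using Op_s_eq program_op_rel(2) snd_Out_best by metis

lemma Op_s_reward_const:
  "program L M \<sigma> \<Longrightarrow> \<exists>c. const_type L c = rew_base L \<and> const_den I c = RewV (fst (Op_s L I M))"
  using Op_s_eq program_op_rel(2) fst_Out_best_const by metis

lemma Op_s_Or_Rwd: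
  assumes "program L M (Base b)" "const_type L c = rew_base L" "const_den I c = RewV r"
    and "const_type L w = b"
  shows "Op_s L I (Or (Rwd (Const c) (Const w)) M) =
    (if r < fst (Op_s L I M) then Op_s L I M else (r, Const w))"
proof -
  let ?A = "Rwd (Const c) (Const w) :: ('b, 'c, 'f) tm"
  have "typing L [] (Const c) (Base (rew_base L))" "typing L [] (Const w) (Base b)"
    using assms(2,4) T_Const by metis+
  then have prog: "program L (Or ?A M) (Base b)"
    using assms(1) by (auto simp: program_def intro!: typing.intros)
  \<comment> \<open>The added left branch is already an effect value; its only strategy has reward
    \<open>r + 0\<close>.\<close>
  have "op_rel L ?A ?A"
    using op_rel.intros(4)[OF eval_ctx.intros(1), of L "Const w" "Const w" c]
    by (simp add: op_rel.intros(1))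
  then have "op_rel L (Or ?A M) (Or ?A (Op L M))"
    using op_rel.intros(3)[OF eval_ctx.intros(1), of L ?A ?A M "Op L M"] program_op_rel(1)[OF assms(1)]
    by simp
  then have "Op L (Or ?A M) = Or ?A (Op L M)" using Op_eqI tt_neq_ff by blast
  then show ?thesis
    using Op_s_eq[OF prog] Op_s_eq[OF assms(1)] assms(3) by simp
qed

lemma Ob_v_equiv_reward:
  assumes "obs_equiv L (Ob_v L I) \<sigma> M N" "program L M \<sigma>" "program L N \<sigma>"
    and C: "\<And>P. program L P \<sigma> \<Longrightarrow> program L (fill C P) (Base (bool_base L))"
  shows "\<not> fst (Op_s L I (fill C M)) < fst (Op_s L I (fill C N))"
proof
  assume less: "fst (Op_s L I (fill C M)) < fst (Op_s L I (fill C N))"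
  \<comment> \<open>\<open>c\<close> names the smaller of the two rewards: the new branch then ties
    with \<open>fill C M\<close> and wins as the left one, but loses to
    \<open>fill C N\<close>.\<close>
  obtain c where c: "const_type L c = rew_base L"
      "const_den I c = RewV (fst (Op_s L I (fill C M)))"
    using Op_s_reward_const[OF C[OF assms(2)]] by blast
  obtain v where v: "snd (Op_s L I (fill C N)) = Const v"
    using Op_s_reducible[OF C[OF assms(3)]] by (auto simp: reducible.simps)
  obtain w where w: "const_type L w = bool_base L" "w \<noteq> v"
    using tt_neq_ff tt_type ff_type by metis
  let ?D = "COr2 (Rwd (Const c) (Const w)) C"
  have "typing L [] (Const c) (Base (rew_base L))" "typing L [] (Const w) (Base (bool_base L))"
    using c(1) w(1) T_Const by metis+
  then have "program L (fill ?D P) (Base (bool_base L))" if "program L P \<sigma>" for P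
    using C[OF that] by (auto simp: program_def intro!: typing.intros)
  then have "Ob_v L I (fill ?D M) = Ob_v L I (fill ?D N)"
    using assms(1) unfolding obs_equiv_def by blast
  moreover have "Ob_v L I (fill ?D M) = Const w"
    using Op_s_Or_Rwd[OF C[OF assms(2)] c w(1)] by (simp add: Ob_v_def)
  moreover have "Ob_v L I (fill ?D N) = Const v"
    using Op_s_Or_Rwd[OF C[OF assms(3)] c w(1)] less v by (simp add: Ob_v_def)
  ultimately show False using w(2) by simp
qed

lemma Op_s_equiv_iff_Ob_v_equiv:
  assumes "program L M \<sigma>" "program L N \<sigma>"
  shows "obs_equiv L (Op_s L I) \<sigma> M N \<longleftrightarrow> obs_equiv L (Ob_v L I) \<sigma> M N"
proof
  assume "obs_equiv L (Op_s L I) \<sigma> M N"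
  then show "obs_equiv L (Ob_v L I) \<sigma> M N" by (simp add: obs_equiv_def Ob_v_def)
next
  assume *: "obs_equiv L (Ob_v L I) \<sigma> M N"
  then have sym: "obs_equiv L (Ob_v L I) \<sigma> N M" by (simp add: obs_equiv_def)
  show "obs_equiv L (Op_s L I) \<sigma> M N"
    unfolding obs_equiv_def
  proof (intro allI impI)
    fix C assume C: "\<forall>P. program L P \<sigma> \<longrightarrow> program L (fill C P) (Base (bool_base L))"
    have "snd (Op_s L I (fill C M)) = snd (Op_s L I (fill C N))"
      using * C by (simp add: obs_equiv_def Ob_v_def)
    moreover have "fst (Op_s L I (fill C M)) = fst (Op_s L I (fill C N))"
      \<comment> \<open>Exchanging \<open>M\<close> and \<open>N\<close> excludes both strict
        inequalities, and rewards are totally ordered.\<close>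
      using Ob_v_equiv_reward[OF * assms, of C] Ob_v_equiv_reward[OF sym assms(2,1), of C] C
      by (meson linorder_neqE)
    ultimately show "Op_s L I (fill C M) = Op_s L I (fill C N)" by (rule prod_eqI[rotated])
  qed
qed

end

theorem theorem4p13:
  fixes L :: "('b, 'c, 'f) language"
    and I :: "('b, 'c, 'f, 'r :: {comm_monoid_add, linorder}, 'x) interp"
    and M N :: "('b, 'c, 'f) tm"
  assumes "selection_model L I"
    and "program L M (Base (bool_base L))"
    and "program L N (Base (bool_base L))"
  shows "obs_equiv L (Op_s L I) (Base (bool_base L)) M N \<longleftrightarrow>
         obs_equiv L (Ob_v L I) (Base (bool_base L)) M N"
  using selection_model.Op_s_equiv_iff_Ob_v_equiv[OF assms] .

end
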